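(* Let $G$ be a graph. (i) If $G$ is connected, then $\mathrm{gp}(G\overline{G})\le n(G)+1$. (ii) If $G$ is disconnected, then $\mathrm{gp}(G\overline{G})\le n(G)$.
   Context: Graphs are finite and simple; $n(G)$ is the number of vertices of $G$ and $\overline{G}$ is the complement of $G$. The complementary prism $G\overline{G}$ is the graph formed from the disjoint union of $G$ and $\overline{G}$ by adding, for each vertex $u\in V(G)$, an edge between $u$ and the corresponding vertex $\overline{u}$ of $\overline{G}$. A geodesic is a shortest path between its two end vertices. A set $S$ of vertices of a graph $H$ is a general position set if no element of $S$ lies on a geodesic of $H$ between two other elements of $S$; $\mathrm{gp}(H)$ is the maximum cardinality of a general position set of $H$. *)

theory Defs
  imports "Graph_Theory.Digraph_Component" "Graph_Theory.Pair_Digraph" "Graph_Theory.Vertex_Walk"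
begin

text \<open>
  A finite simple graph is a finite, symmetric, loop-free digraph without parallel arcs
  (\<^locale>\<open>pair_graph\<close>): an edge between u and v is the pair of arcs (u, v) and (v, u).
\<close>

definition graph_complement :: "'a pair_pre_digraph \<Rightarrow> 'a pair_pre_digraph" where
  "graph_complement G =
    \<lparr>pverts = pverts G,
     parcs = {(u, v). u \<in> pverts G \<and> v \<in> pverts G \<and> u \<noteq> v \<and> (u, v) \<notin> parcs G}\<rparr>"

text \<open>
  The vertices of the copy of G are tagged with \<^const>\<open>Inl\<close>, those of the copy of the
  complement with \<^const>\<open>Inr\<close>; the vertex corresponding to Inl u is Inr u.
\<close>

definition complementary_prism :: "'a pair_pre_digraph \<Rightarrow> ('a + 'a) pair_pre_digraph" where
  "complementary_prism G =
    \<lparr>pverts = pverts G <+> pverts (graph_complement G),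
     parcs = {(Inl u, Inl v) |u v. (u, v) \<in> parcs G}
       \<union> {(Inr u, Inr v) |u v. (u, v) \<in> parcs (graph_complement G)}
       \<union> {(Inl u, Inr u) |u. u \<in> pverts G}
       \<union> {(Inr u, Inl u) |u. u \<in> pverts G}\<rparr>"

definition geodesic :: "'a pair_pre_digraph \<Rightarrow> 'a \<Rightarrow> 'a vwalk \<Rightarrow> 'a \<Rightarrow> bool" where
  "geodesic H u p v \<longleftrightarrow>
    vpath p (with_proj H) \<and> hd p = u \<and> last p = v \<and>
    (\<forall>q. vpath q (with_proj H) \<and> hd q = u \<and> last q = v \<longrightarrow> vwalk_length p \<le> vwalk_length q)"

definition general_position_set :: "'a pair_pre_digraph \<Rightarrow> 'a set \<Rightarrow> bool" where
  "general_position_set H S \<longleftrightarrow>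
    S \<subseteq> pverts H \<and>
    (\<forall>x\<in>S. \<forall>u\<in>S. \<forall>v\<in>S. u \<noteq> v \<and> x \<noteq> u \<and> x \<noteq> v \<longrightarrow>
      \<not> (\<exists>p. geodesic H u p v \<and> x \<in> set p))"

definition gp_number :: "'a pair_pre_digraph \<Rightarrow> nat" where
  "gp_number H = Max {card S |S. general_position_set H S}"

lemma pair_graph_complement:
  assumes "pair_graph G"
  shows "pair_graph (graph_complement G)"
proof -
  interpret pair_graph G by fact
  have "finite (parcs (graph_complement G))"
    by (rule finite_subset[of _ "pverts G \<times> pverts G"])
      (auto simp: graph_complement_def pair_finite_verts)
  then show ?thesis
    by unfold_locales
      (auto simp: graph_complement_def pair_finite_verts symmetric_def sym_def
        dest: arcs_symmetric)
qed

lemma pair_graph_complementary_prism: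
  assumes "pair_graph G"
  shows "pair_graph (complementary_prism G)"
proof -
  interpret G: pair_graph G by fact
  interpret C: pair_graph "graph_complement G" by (rule pair_graph_complement) fact
  have V: "pverts (graph_complement G) = pverts G" by (simp add: graph_complement_def)
  have fv: "finite (pverts (complementary_prism G))"
    by (simp add: complementary_prism_def G.pair_finite_verts C.pair_finite_verts)
  have sub: "parcs (complementary_prism G)
      \<subseteq> pverts (complementary_prism G) \<times> pverts (complementary_prism G)"
    by (auto simp: complementary_prism_def V
        dest: G.in_arcsD1 G.in_arcsD2 C.in_arcsD1[unfolded V] C.in_arcsD2[unfolded V])
  have "finite (parcs (complementary_prism G))"
    using finite_subset[OF sub] fv by blast
  moreover have "fst e \<noteq> snd e" if "e \<in> parcs (complementary_prism G)" for e
    using that by (auto simp: complementary_prism_def dest: G.no_loops' C.no_loops')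
  moreover have "symmetric (with_proj (complementary_prism G))"
    by (auto simp: symmetric_def sym_def complementary_prism_def
        dest: G.arcs_symmetric C.arcs_symmetric)
  ultimately show ?thesis
    using fv sub by unfold_locales auto
qed

text \<open>The maximum in \<^const>\<open>gp_number\<close> is taken over a finite nonempty set.\<close>

lemma gp_number_wf:
  assumes "finite (pverts H)"
  shows "finite {card S |S. general_position_set H S}" "{card S |S. general_position_set H S} \<noteq> {}"
proof -
  have "{card S |S. general_position_set H S} \<subseteq> card ` Pow (pverts H)"
    by (auto simp: general_position_set_def)
  then show "finite {card S |S. general_position_set H S}"
    using assms by (meson finite_Pow_iff finite_imageI finite_subset)
  have "general_position_set H {}" by (simp add: general_position_set_def)
  then show "{card S |S. general_position_set H S} \<noteq> {}" by blast
qed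

end

theory Submission
  imports Defs
begin

text \<open>
  Let S be a general position set of the prism, A its trace on G and B its trace on the
  complement, so that |S| = |A \<union> B| + |A \<inter> B|. If both u and its copy u' lie in S, then A contains
  no neighbour v of u (else u', u, v is a geodesic) and, dually, all other vertices of B are
  neighbours of u. Hence A and B meet in at most one vertex, and |S| \<le> n + 1. If equality holds,
  then A \<union> B = V and A \<inter> B = {u}. A vertex w outside the component of u is not adjacent to u, so
  it lies in A, but then u, u', w', w is a geodesic containing three elements of S.
\<close>

text \<open>A shorter path has at most two vertices: a single vertex would force
  \<open>u = v\<close>, and two would make \<open>u\<close> and \<open>v\<close> adjacent.\<close>

lemma geodesic_length_2I:
  assumes "{u, x, v} \<subseteq> pverts H" "(u, x) \<in> parcs H" "(x, v) \<in> parcs H" "distinct [u, x, v]"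
    and nonadj: "(u, v) \<notin> parcs H"
  shows "geodesic H u [u, x, v] v"
proof -
  have "vwalk_length [u, x, v] \<le> vwalk_length q"
    if q: "vpath q (with_proj H)" "hd q = u" "last q = v" for q
  proof (rule ccontr)
    assume "\<not> vwalk_length [u, x, v] \<le> vwalk_length q"
    then consider "q = []" | a where "q = [a]" | a b where "q = [a, b]"
      by (cases q; cases "tl q"; cases "tl (tl q)") auto
    then show False
      using q assms by cases (auto simp: vpath_def vwalk_def)
  qed
  moreover have "vpath [u, x, v] (with_proj H)"
    using assms by (auto simp: vpath_def vwalk_def)
  ultimately show ?thesis
    by (simp add: geodesic_def del: vwalk_length_simp)
qed

text \<open>The new competitor is a path on three vertices, whose middle vertex would be a common
  neighbour, contrary to \<open>no_common\<close>.\<close>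

lemma geodesic_length_3I:
  assumes "{u, x, y, v} \<subseteq> pverts H"
    and "(u, x) \<in> parcs H" "(x, y) \<in> parcs H" "(y, v) \<in> parcs H" "distinct [u, x, y, v]"
    and nonadj: "(u, v) \<notin> parcs H"
    and no_common: "\<And>z. (u, z) \<in> parcs H \<Longrightarrow> (z, v) \<notin> parcs H"
  shows "geodesic H u [u, x, y, v] v"
proof -
  have "vwalk_length [u, x, y, v] \<le> vwalk_length q"
    if q: "vpath q (with_proj H)" "hd q = u" "last q = v" for q
  proof (rule ccontr)
    assume "\<not> vwalk_length [u, x, y, v] \<le> vwalk_length q"
    then consider "q = []" | a where "q = [a]" | a b where "q = [a, b]"
      | a b c where "q = [a, b, c]"
      by (cases q; cases "tl q"; cases "tl (tl q)"; cases "tl (tl (tl q))") auto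
    then show False
      using q assms by cases (auto simp: vpath_def vwalk_def)
  qed
  moreover have "vpath [u, x, y, v] (with_proj H)"
    using assms by (auto simp: vpath_def vwalk_def)
  ultimately show ?thesis
    by (simp add: geodesic_def del: vwalk_length_simp)
qed

lemma general_position_setD:
  assumes "general_position_set H S" "geodesic H u p v"
    and "u \<in> S" "v \<in> S" "x \<in> S" "x \<in> set p" "u \<noteq> v" "x \<noteq> u" "x \<noteq> v"
  shows False
  using assms unfolding general_position_set_def by blast

lemma pverts_complementary_prism [simp]:
  "Inl u \<in> pverts (complementary_prism G) \<longleftrightarrow> u \<in> pverts G"
  "Inr u \<in> pverts (complementary_prism G) \<longleftrightarrow> u \<in> pverts G"
  by (auto simp: complementary_prism_def graph_complement_def)

lemma parcs_complementary_prism [simp]: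
  "(Inl u, Inl v) \<in> parcs (complementary_prism G) \<longleftrightarrow> (u, v) \<in> parcs G"
  "(Inr u, Inr v) \<in> parcs (complementary_prism G) \<longleftrightarrow>
    u \<in> pverts G \<and> v \<in> pverts G \<and> u \<noteq> v \<and> (u, v) \<notin> parcs G"
  "(Inl u, Inr v) \<in> parcs (complementary_prism G) \<longleftrightarrow> u \<in> pverts G \<and> u = v"
  "(Inr u, Inl v) \<in> parcs (complementary_prism G) \<longleftrightarrow> u \<in> pverts G \<and> u = v"
  by (auto simp: complementary_prism_def graph_complement_def)

lemma gp_number_le:
  assumes "finite (pverts H)" "\<And>S. general_position_set H S \<Longrightarrow> card S \<le> k"
  shows "gp_number H \<le> k"
  using gp_number_wf[OF assms(1)] assms(2) unfolding gp_number_def by (subst Max_le_iff) auto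

context pair_graph
begin

lemma not_connected_ex_unreachable:
  assumes "\<not> Digraph_Component.connected (with_proj G)" "u \<in> pverts G"
  obtains w where "w \<in> pverts G" "\<not> u \<rightarrow>\<^sup>*\<^bsub>with_proj G\<^esub> w"
proof -
  \<comment> \<open>\<open>connected\<close> also demands that there is a vertex. Since
    \<open>u\<close> is one, its failure must come from a pair \<open>a\<close>, \<open>b\<close>;
    as arcs are symmetric, reaching both from \<open>u\<close> would join \<open>a\<close> to
    \<open>b\<close>.\<close>
  obtain a b where ab: "a \<in> pverts G" "b \<in> pverts G" "\<not> a \<rightarrow>\<^sup>*\<^bsub>with_proj G\<^esub> b"
    using assms reachable_mk_symmetric_eq[OF sym_arcs]
    unfolding connected_def strongly_connected_def by auto
  then have "\<not> u \<rightarrow>\<^sup>*\<^bsub>with_proj G\<^esub> a \<or> \<not> u \<rightarrow>\<^sup>*\<^bsub>with_proj G\<^esub> b"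
    by (meson reachable_trans symmetric_reachable')
  then show ?thesis using ab that by blast
qed

context
  fixes S
  assumes gp: "general_position_set (complementary_prism G) S"
begin

lemma gp_set_vertsD:
  "Inl u \<in> S \<Longrightarrow> u \<in> pverts G" "Inr u \<in> S \<Longrightarrow> u \<in> pverts G"
  using gp unfolding general_position_set_def
  by (meson pverts_complementary_prism subsetD)+

text \<open>Matching edges join only corresponding vertices, so \<open>Inr u\<close> and
  \<open>Inl v\<close> are not adjacent when u and v differ, and an edge uv puts
  \<open>Inl u\<close> on a geodesic between them.\<close>

lemma gp_set_not_adjacent:
  assumes "Inl u \<in> S" "Inr u \<in> S" "Inl v \<in> S"
  shows "(u, v) \<notin> parcs G"
proof
  assume uv: "(u, v) \<in> parcs G"
  then have "u \<noteq> v" using no_loops' by blast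
  then have "geodesic (complementary_prism G) (Inr u) [Inr u, Inl u, Inl v] (Inl v)"
    using uv assms by (intro geodesic_length_2I) (auto dest: gp_set_vertsD)
  then show False
    using general_position_setD[OF gp, of _ _ _ "Inl u"] assms \<open>u \<noteq> v\<close> by fastforce
qed

text \<open>The dual situation: a non-edge uv of G is an edge of the complement, which puts
  \<open>Inr u\<close> between \<open>Inl u\<close> and \<open>Inr v\<close>.\<close>

lemma gp_set_adjacent:
  assumes "Inl u \<in> S" "Inr u \<in> S" "Inr v \<in> S" "u \<noteq> v"
  shows "(u, v) \<in> parcs G"
proof (rule ccontr)
  assume "(u, v) \<notin> parcs G"
  then have "geodesic (complementary_prism G) (Inl u) [Inl u, Inr u, Inr v] (Inr v)"
    using assms by (intro geodesic_length_2I) (auto dest: gp_set_vertsD)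
  then show False
    using general_position_setD[OF gp, of _ _ _ "Inr u"] assms by fastforce
qed

text \<open>The detour through the complement is available because u and w are not adjacent in G,
  and it is shortest because nothing shorter joins them inside the copy of G.\<close>

lemma gp_set_unreachable:
  assumes "Inl u \<in> S" "Inr u \<in> S" "w \<in> pverts G" "\<not> u \<rightarrow>\<^sup>*\<^bsub>with_proj G\<^esub> w"
  shows "Inl w \<notin> S"
proof
  assume w: "Inl w \<in> S"
  have u: "u \<in> pverts G" using assms gp_set_vertsD by blast
  then have "u \<noteq> w" using assms by auto
  have nonadj: "(u, w) \<notin> parcs G"
    using assms by auto
  have no_common: "(z, w) \<notin> parcs G" if "(u, z) \<in> parcs G" for z
    using that assms by (meson reachable_adjI reachable_adj_trans)
  \<comment> \<open>A common neighbour in the copy of G would make w reachable from u; one in the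
    complement would be both \<open>Inr u\<close> and \<open>Inr w\<close>.\<close>
  have "(Inl u, z) \<in> parcs (complementary_prism G) \<Longrightarrow>
      (z, Inl w) \<notin> parcs (complementary_prism G)" for z
    using no_common \<open>u \<noteq> w\<close> by (cases z) auto
  then have "geodesic (complementary_prism G) (Inl u) [Inl u, Inr u, Inr w, Inl w] (Inl w)"
    using u assms \<open>u \<noteq> w\<close> nonadj by (intro geodesic_length_3I) auto
  then show False
    using general_position_setD[OF gp, of _ _ _ "Inr u"] assms w \<open>u \<noteq> w\<close> by fastforce
qed

text \<open>S is the disjoint sum of its two traces, and card A + card B is regrouped by
  inclusion-exclusion. The union is bounded by the vertex set, so only the intersection can push
  card S above n.\<close>

lemma gp_set_card_eq:
  "card S = card (Inl -` S \<union> Inr -` S) + card (Inl -` S \<inter> Inr -` S)"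
  "Inl -` S \<union> Inr -` S \<subseteq> pverts G"
proof -
  show sub: "Inl -` S \<union> Inr -` S \<subseteq> pverts G"
    using gp_set_vertsD by auto
  then have "finite (Inl -` S)" "finite (Inr -` S)"
    using finite_subset[OF _ pair_finite_verts] by auto
  moreover have "S = Inl -` S <+> Inr -` S"
    by (auto simp: Plus_def image_iff) (metis sumE)
  ultimately show "card S = card (Inl -` S \<union> Inr -` S) + card (Inl -` S \<inter> Inr -` S)"
    by (metis card_Plus card_Un_Int)
qed

text \<open>A second common vertex would be both adjacent and not adjacent to u.\<close>

lemma gp_set_traces_Int:
  assumes "u \<in> Inl -` S \<inter> Inr -` S"
  shows "Inl -` S \<inter> Inr -` S = {u}"
  using assms gp_set_not_adjacent[of u] gp_set_adjacent[of u] by auto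

lemma card_gp_set_le: "card S \<le> card (pverts G) + 1"
proof -
  have "card (Inl -` S \<inter> Inr -` S) \<le> 1"
    using gp_set_traces_Int by (cases "Inl -` S \<inter> Inr -` S = {}") (fastforce, force)
  then show ?thesis
    using gp_set_card_eq card_mono[OF pair_finite_verts gp_set_card_eq(2)] by linarith
qed

lemma card_gp_set_le_of_not_connected:
  assumes "\<not> Digraph_Component.connected (with_proj G)"
  shows "card S \<le> card (pverts G)"
proof (cases "Inl -` S \<inter> Inr -` S = {}")
  case True
  then show ?thesis
    using gp_set_card_eq(1) card_mono[OF pair_finite_verts gp_set_card_eq(2)] by simp
next
  case False
  then obtain u where u: "Inl u \<in> S" "Inr u \<in> S" by auto
  then obtain w where w: "w \<in> pverts G" "\<not> u \<rightarrow>\<^sup>*\<^bsub>with_proj G\<^esub> w"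
    using not_connected_ex_unreachable[OF assms] gp_set_vertsD by blast
  moreover have "u \<noteq> w" using w by auto
  \<comment> \<open>\<open>Inr w\<close> in S would make w a neighbour of u, hence reachable. The
    vertex w missed by both traces offsets the one vertex counted twice.\<close>
  ultimately have "w \<notin> Inl -` S \<union> Inr -` S"
    using u gp_set_unreachable gp_set_adjacent by auto
  then have "card (Inl -` S \<union> Inr -` S) < card (pverts G)"
    using w gp_set_card_eq(2) by (intro psubset_card_mono[OF pair_finite_verts]) auto
  moreover have "card (Inl -` S \<inter> Inr -` S) = 1"
    using gp_set_traces_Int[of u] u by simp
  ultimately show ?thesis
    using gp_set_card_eq(1) by simp
qed

end

end

theorem theorem3p1:
  fixes G :: "'a pair_pre_digraph"
  assumes "pair_graph G"
  shows "(Digraph_Component.connected (with_proj G) \<longrightarrow>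
            gp_number (complementary_prism G) \<le> card (pverts G) + 1)
       \<and> (\<not> Digraph_Component.connected (with_proj G) \<longrightarrow>
            gp_number (complementary_prism G) \<le> card (pverts G))"
proof -
  interpret pair_graph G by fact
  have "finite (pverts (complementary_prism G))"
    using pair_graph_complementary_prism[OF assms]
    by (simp add: pair_graph_def pair_digraph_def pair_fin_digraph.pair_finite_verts)
  then show ?thesis
    by (intro conjI impI gp_number_le card_gp_set_le card_gp_set_le_of_not_connected)
qed

end
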